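(* Let $R>0$ be such that $2R^2\ge\max\{R_{c^1}^2,R_{c^2}^2\}$. Over the far regime $r_1^2+r_2^2\ge\max\{R_{c^1}^2,R_{c^2}^2\}$, $$\begin{aligned}\sup_{\substack{r_1,r_2\in[0,R],\ \theta\in[0,2\pi)\\ r_1^2+r_2^2\ge\max\{R_{c^1}^2,R_{c^2}^2\}}}\sigma^2_{\mathcal{E}}(r_1,r_2,\theta)\ \le\ {}&2\Big(h(0)-h\big(8R^2\big)\Big)+4\Big(-h'(0)+2h'\big(2R^2\big)\Big)\big(4R^2\big)\\&+4\Big(h''(0)-2h''\big(2R^2\big)\Big)\big(4R^4\big).\end{aligned}$$
   Context: Let $h:[0,\infty)\to\mathbb{R}$ be twice continuously differentiable such that $h\ge0$ and $h''\ge0$ are both monotone decreasing and $h'\le0$ is monotone increasing. (Here $h$ is the function with $k_u(x,y)=h(\|x-y\|_2^2)$ for the covariance of an isotropic mean-zero Gaussian field $u$ on $\mathbb{R}^D\times\mathbb{R}^D$.) Let $\sigma^2_{\mathcal{E}}(r_1,r_2,\theta)$ denote the pointwise variance, in polar form, of the error of the second-order Taylor approximation at $(z^*,z^* )$ of $f(x^{(1)},x^{(2)})=u(x^{(1)},x^{(2)})-u(x^{(2)},x^{(1)})$, evaluated at inputs at distances $r_1,r_2\ge 0$ from $z^*$ with relative angle $\theta$: $$\begin{aligned}\sigma^2_{\mathcal{E}}(r_1,r_2,\theta)={}&2\Big(h(0)-h\big(2(r_1^2+r_2^2-2r_1r_2\cos\theta)\big)\Big)\\&+4\Big(-h'(0)+2h'(r_1^2+r_2^2)\Big)\Big(r_1^2+r_2^2-2r_1r_2\cos\theta\Big)\\&+4\Big(h''(0)-2h''(r_1^2+r_2^2)\Big)\Big((r_1^2+r_2^2)^2-4r_1^2r_2^2\cos^2\theta\Big).\end{aligned}$$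 The critical radii $R_{c^1},R_{c^2}\ge0$ are assumed to exist and are defined by $-h'(0)+2h'(R_{c^1}^2)=0$ and $h''(0)-2h''(R_{c^2}^2)=0$. *)

theory Defs
  imports Complex_Main "HOL-Library.Extended_Real"
begin

text \<open>
  For an isotropic centred Gaussian field \<open>u\<close> with covariance kernel \<open>h (norm (x - y) ^ 2)\<close>,
  this is the variance, in polar form, of \<open>f - T\<close> with \<open>f (x1, x2) = u (x1, x2) - u (x2, x1)\<close>
  and \<open>T\<close> the second-order Taylor polynomial of \<open>f\<close> at \<open>(z, z)\<close>. The inputs lie at distances
  \<open>r1\<close>, \<open>r2\<close> from \<open>z\<close>, at relative angle \<open>\<theta>\<close>. The three summands are the variance of \<open>f\<close> and
  the contributions (variance minus twice the covariance with \<open>f\<close>) of the linear and the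
  quadratic part of \<open>T\<close>; these two parts are uncorrelated.
  The arguments \<open>h'\<close> and \<open>h''\<close> are the first and second derivative of \<open>h\<close> on \<open>[0, \<infinity>)\<close>.
\<close>

definition taylor_error_variance ::
  "(real \<Rightarrow> real) \<Rightarrow> (real \<Rightarrow> real) \<Rightarrow> (real \<Rightarrow> real) \<Rightarrow> real \<Rightarrow> real \<Rightarrow> real \<Rightarrow> real" where
  "taylor_error_variance h h' h'' r1 r2 \<theta> =
     2 * (h 0 - h (2 * (r1\<^sup>2 + r2\<^sup>2 - 2 * r1 * r2 * cos \<theta>)))
   + 4 * (- h' 0 + 2 * h' (r1\<^sup>2 + r2\<^sup>2)) * (r1\<^sup>2 + r2\<^sup>2 - 2 * r1 * r2 * cos \<theta>)
   + 4 * (h'' 0 - 2 * h'' (r1\<^sup>2 + r2\<^sup>2)) * ((r1\<^sup>2 + r2\<^sup>2)\<^sup>2 - 4 * r1\<^sup>2 * r2\<^sup>2 * (cos \<theta>)\<^sup>2)"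

end

theory Submission
  imports Defs
begin

text \<open>
  Write \<open>s = r1\<^sup>2 + r2\<^sup>2\<close> and \<open>x = r1\<^sup>2 + r2\<^sup>2 - 2 * r1 * r2 * cos \<theta>\<close> (the squared distance of the two
  inputs). Beyond the critical radii the coefficients \<open>- h' 0 + 2 * h' s\<close> and \<open>h'' 0 - 2 * h'' s\<close>
  are nonnegative: they vanish at \<open>Rc1\<^sup>2\<close> and \<open>Rc2\<^sup>2\<close> and grow with \<open>s\<close>, because \<open>h'\<close> is increasing
  and \<open>h''\<close> decreasing. All three summands of the variance can therefore be maximised separately:
  the first through \<open>0 \<le> x \<le> 2 * s\<close> and the monotonicity of \<open>h\<close>, the other two as products of
  nonnegative factors, where \<open>s \<le> 2 * R\<^sup>2\<close> bounds the coefficients and the geometric factors are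
  at most \<open>2 * s\<close> and \<open>s\<^sup>2\<close>.

  This separation costs sharpness. For \<open>r1 = r2 = R\<close>, the squared distance reaches \<open>2 * s\<close> only for
  antipodal inputs (\<open>cos \<theta> = - 1\<close>), the quadratic factor reaches \<open>s\<^sup>2\<close> only for orthogonal ones.
\<close>

text \<open>
  The law-of-cosines expression lies between \<open>(r1 - r2)\<^sup>2\<close> and \<open>(r1 + r2)\<^sup>2\<close>; the latter is at most
  twice the sum of squares by the inequality of arithmetic and geometric means.
\<close>

lemma law_of_cosines_bounds:
  fixes r1 r2 \<theta> :: real
  assumes "0 \<le> r1" "0 \<le> r2"
  shows "0 \<le> r1\<^sup>2 + r2\<^sup>2 - 2 * r1 * r2 * cos \<theta>"
    and "r1\<^sup>2 + r2\<^sup>2 - 2 * r1 * r2 * cos \<theta> \<le> 2 * (r1\<^sup>2 + r2\<^sup>2)"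
proof -
  have "\<bar>r1 * r2 * cos \<theta>\<bar> \<le> r1 * r2"
    using assms by (simp add: abs_mult mult_left_le)
  moreover have "2 * (r1 * r2) \<le> r1\<^sup>2 + r2\<^sup>2"
    using sum_squares_bound[of r1 r2] by (simp add: mult.assoc)
  ultimately show "0 \<le> r1\<^sup>2 + r2\<^sup>2 - 2 * r1 * r2 * cos \<theta>"
    and "r1\<^sup>2 + r2\<^sup>2 - 2 * r1 * r2 * cos \<theta> \<le> 2 * (r1\<^sup>2 + r2\<^sup>2)"
    by (simp_all add: mult.assoc)
qed

text \<open>
  The factor of the quadratic part is the product of the squared norms of the difference and the
  sum of the two inputs, hence nonnegative; dropping the cosine term bounds it from above.
\<close>

lemma quadratic_factor_bounds:
  fixes r1 r2 \<theta> :: real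
  assumes "0 \<le> r1" "0 \<le> r2"
  shows "0 \<le> (r1\<^sup>2 + r2\<^sup>2)\<^sup>2 - 4 * r1\<^sup>2 * r2\<^sup>2 * (cos \<theta>)\<^sup>2"
    and "(r1\<^sup>2 + r2\<^sup>2)\<^sup>2 - 4 * r1\<^sup>2 * r2\<^sup>2 * (cos \<theta>)\<^sup>2 \<le> (r1\<^sup>2 + r2\<^sup>2)\<^sup>2"
proof -
  have "(r1\<^sup>2 + r2\<^sup>2)\<^sup>2 - 4 * r1\<^sup>2 * r2\<^sup>2 * (cos \<theta>)\<^sup>2 =
      (r1\<^sup>2 + r2\<^sup>2 - 2 * r1 * r2 * cos \<theta>) * (r1\<^sup>2 + r2\<^sup>2 + 2 * r1 * r2 * cos \<theta>)"
    by (simp add: power2_eq_square algebra_simps)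
  moreover have "0 \<le> r1\<^sup>2 + r2\<^sup>2 + 2 * r1 * r2 * cos \<theta>"
    using law_of_cosines_bounds(2)[OF assms, of \<theta>] by simp
  ultimately show "0 \<le> (r1\<^sup>2 + r2\<^sup>2)\<^sup>2 - 4 * r1\<^sup>2 * r2\<^sup>2 * (cos \<theta>)\<^sup>2"
    using law_of_cosines_bounds(1)[OF assms, of \<theta>] by simp
qed simp

text \<open>
  The number \<open>m\<close> stands for the larger of the two squared critical radii. Both coefficients increase
  with \<open>r1\<^sup>2 + r2\<^sup>2\<close>, so their signs at \<open>m\<close> persist on the whole far regime. There the last two
  summands are products of nonnegative factors, which can be bounded factor by factor.
\<close>

lemma taylor_error_variance_far_le:
  fixes h h' h'' :: "real \<Rightarrow> real" and m r1 r2 R \<theta> :: real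
  assumes h: "antimono_on {0..} h" and h': "mono_on {0..} h'" and h'': "antimono_on {0..} h''"
    and m: "0 \<le> m" "0 \<le> - h' 0 + 2 * h' m" "0 \<le> h'' 0 - 2 * h'' m"
    and r: "0 \<le> r1" "r1 \<le> R" "0 \<le> r2" "r2 \<le> R"
    and far: "m \<le> r1\<^sup>2 + r2\<^sup>2"
  shows "taylor_error_variance h h' h'' r1 r2 \<theta>
    \<le> 2 * (h 0 - h (8 * R\<^sup>2))
      + 4 * (- h' 0 + 2 * h' (2 * R\<^sup>2)) * (4 * R\<^sup>2)
      + 4 * (h'' 0 - 2 * h'' (2 * R\<^sup>2)) * (4 * R ^ 4)"
proof -
  define s where "s = r1\<^sup>2 + r2\<^sup>2"
  define x where "x = s - 2 * r1 * r2 * cos \<theta>"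
  define q where "q = s\<^sup>2 - 4 * r1\<^sup>2 * r2\<^sup>2 * (cos \<theta>)\<^sup>2"
  have "s \<le> 2 * R\<^sup>2"
    using power_mono[OF r(2,1), of 2] power_mono[OF r(4,3), of 2] unfolding s_def by linarith
  then have s: "0 \<le> s" "m \<le> s" "s \<le> 2 * R\<^sup>2"
    using far by (simp_all add: s_def)
  have x: "0 \<le> x" "x \<le> 4 * R\<^sup>2"
    using law_of_cosines_bounds[OF r(1,3), of \<theta>] s(3) by (auto simp: x_def s_def)
  have "q \<le> (2 * R\<^sup>2)\<^sup>2"
    using quadratic_factor_bounds(2)[OF r(1,3), of \<theta>] power_mono[OF s(3,1), of 2]
    unfolding q_def s_def by linarith
  then have q: "0 \<le> q" "q \<le> 4 * R ^ 4"
    using quadratic_factor_bounds(1)[OF r(1,3), of \<theta>]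
    by (simp_all add: q_def s_def power_mult_distrib flip: power_mult)
  have "h (8 * R\<^sup>2) \<le> h (2 * x)"
    using monotone_onD[OF h, of "2 * x" "8 * R\<^sup>2"] x by simp
  moreover have "(- h' 0 + 2 * h' s) * x \<le> (- h' 0 + 2 * h' (2 * R\<^sup>2)) * (4 * R\<^sup>2)"
  proof (rule mult_mono')
    show "- h' 0 + 2 * h' s \<le> - h' 0 + 2 * h' (2 * R\<^sup>2)"
      using monotone_onD[OF h', of s "2 * R\<^sup>2"] s by simp
    show "0 \<le> - h' 0 + 2 * h' s"
      using monotone_onD[OF h', of m s] m(1,2) s by simp
  qed (use x in simp_all)
  moreover have "(h'' 0 - 2 * h'' s) * q \<le> (h'' 0 - 2 * h'' (2 * R\<^sup>2)) * (4 * R ^ 4)"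
  proof (rule mult_mono')
    show "h'' 0 - 2 * h'' s \<le> h'' 0 - 2 * h'' (2 * R\<^sup>2)"
      using monotone_onD[OF h'', of s "2 * R\<^sup>2"] s by simp
    show "0 \<le> h'' 0 - 2 * h'' s"
      using monotone_onD[OF h'', of m s] m(1,3) s by simp
  qed (use q in simp_all)
  moreover have "taylor_error_variance h h' h'' r1 r2 \<theta> =
      2 * (h 0 - h (2 * x)) + 4 * ((- h' 0 + 2 * h' s) * x) + 4 * ((h'' 0 - 2 * h'' s) * q)"
    unfolding taylor_error_variance_def x_def q_def s_def by (simp only: mult.assoc)
  ultimately show ?thesis
    by (simp only: mult.assoc) (intro add_mono mult_left_mono; simp)
qed

theorem proposition35:
  fixes h h' h'' :: "real \<Rightarrow> real" and R Rc1 Rc2 :: real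
  assumes deriv1: "\<And>x. 0 \<le> x \<Longrightarrow> (h has_real_derivative h' x) (at x within {0..})"
    and deriv2: "\<And>x. 0 \<le> x \<Longrightarrow> (h' has_real_derivative h'' x) (at x within {0..})"
    and cont2: "continuous_on {0..} h''"
    and h_nonneg: "\<And>x. 0 \<le> x \<Longrightarrow> 0 \<le> h x"
    and h_decreasing: "antimono_on {0..} h"
    and h'_nonpos: "\<And>x. 0 \<le> x \<Longrightarrow> h' x \<le> 0"
    and h'_increasing: "mono_on {0..} h'"
    and h''_nonneg: "\<And>x. 0 \<le> x \<Longrightarrow> 0 \<le> h'' x"
    and h''_decreasing: "antimono_on {0..} h''"
    and Rc1: "0 \<le> Rc1" "- h' 0 + 2 * h' (Rc1\<^sup>2) = 0"
    and Rc2: "0 \<le> Rc2" "h'' 0 - 2 * h'' (Rc2\<^sup>2) = 0"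
    and R: "0 < R" "2 * R\<^sup>2 \<ge> max (Rc1\<^sup>2) (Rc2\<^sup>2)"
  shows "(SUP (r1, r2, \<theta>) \<in> {(r1, r2, \<theta>). r1 \<in> {0..R} \<and> r2 \<in> {0..R} \<and> \<theta> \<in> {0..<2 * pi} \<and>
                                 r1\<^sup>2 + r2\<^sup>2 \<ge> max (Rc1\<^sup>2) (Rc2\<^sup>2)}.
            ereal (taylor_error_variance h h' h'' r1 r2 \<theta>))
         \<le> ereal (2 * (h 0 - h (8 * R\<^sup>2))
                 + 4 * (- h' 0 + 2 * h' (2 * R\<^sup>2)) * (4 * R\<^sup>2)
                 + 4 * (h'' 0 - 2 * h'' (2 * R\<^sup>2)) * (4 * R ^ 4))"
proof -
  define m where "m = max (Rc1\<^sup>2) (Rc2\<^sup>2)"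
  have m: "0 \<le> m" "Rc1\<^sup>2 \<le> m" "Rc2\<^sup>2 \<le> m"
    by (auto simp: m_def le_max_iff_disj)
  have coeff1: "0 \<le> - h' 0 + 2 * h' m"
    using monotone_onD[OF h'_increasing, of "Rc1\<^sup>2" m] Rc1(2) m by simp
  have coeff2: "0 \<le> h'' 0 - 2 * h'' m"
    using monotone_onD[OF h''_decreasing, of "Rc2\<^sup>2" m] Rc2(2) m by simp
  show ?thesis
    unfolding m_def[symmetric]
    by (intro SUP_least, clarify, unfold ereal_less_eq, rule taylor_error_variance_far_le[OF
          h_decreasing h'_increasing h''_decreasing m(1) coeff1 coeff2]) auto
qed

end
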